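(* Consider an execution on a leveled substrate whose stations all reside at level $0$, with level-$0$ hold power $p_0$, fare $c_0$ across the boundary between levels $0$ and $1$, and a number $\gamma_{\mathrm{rc}}$. Suppose the execution carries an annotation by values such that: (i) distinct live values occupy pairwise disjoint physical bits; (ii) for each value $v$, every level-$0$ firing that writes bits of $v$, other than the one creating $v$, writes bits of no other value and is either a copy (it reads the same bits of $v$ from a level-$0$-resident copy) or belongs to a recomputation route of $v$. Here the non-copy firings are partitioned into routes; a route writes bits of one value, all of them in its last firing, reads no bit of that value, and dissipates at least $\gamma_{\mathrm{rc}}$ per bit it writes, counted per write (a bit written twice, by two routes, is paid twice). Bits a route writes that belong to no value (its intermediates) are unlabeled and free of (i) and (ii). For each value $v$ of footprint $\beta_v$ bits, let $t^v_0$ be its creation time and let $t^v_1\le\dots\le t^v_{k_v}$ be the times of the level-$0$ operations reading it, other than copy firings. Call bit $b$ of $v$ covered at use $i$ if at every instant of $[t^v_{i-1},t^v_i]$ some level-$0$ copy of $b$ is resident. Then the energy $E$ of the execution satisfies $$E\;\ge\;\sum_v\sum_{i=1}^{k_v}\sum_b \mathrm{ch}(v,i,b),$$ where $b$ ranges over the bits of $v$ and $$\mathrm{ch}(v,i,b)=\begin{cases}\min\big(p_0\,(t^v_i-t^v_{i-1}),\,c_0,\,\gamma_{\mathrm{rc}}\big)&\text{if } b \text{ is covered at use } i,\\ \min(c_0,\gamma_{\mathrm{rc}})&\text{otherwise.}\end{cases}$$ In particular $E\ge\sum_v\sum_i\beta_v\min\big(p_0(t^v_i-t^v_{i-1}),c_0,\gamma_{\mathrm{rc}}\big)$.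 Moreover the charged energy is disjoint from the energies of the reading operations that are not route firings of another value.
   Context: Substrate and executions. Storage consists of one-bit cells at levels $0,1,2,\dots$; level $\ell$ holds at most $S_\ell$ bits and has hold power $p_\ell\ge0$ (least energy per resident bit per unit time). The outermost level is an environment of unbounded capacity and hold power $0$; the others are working levels. Moving a bit across the boundary between levels $\ell$ and $\ell+1$ costs energy $c_\ell$ (the fare). Operations fire at stations (here all at level $0$), reading at most two words ($w$ consecutive cells) resident at level $0$ and writing bits at level $0$. A bit is live while it is held at a working level. An execution is a finite sequence of states, consecutive states related by a step, which is: a hold (time advances by some $d>0$; nothing is read, written, created or destroyed), a move (one bit is copied across one boundary into a free cell at the far level; the source stays as it was), or a fire (one operation at one station; it may also free live bits, which cease to be live). Moves and fires take no time. The energy $E$ of an execution is at least the sum of the energies of its operations, plus $\sum_\ell p_\ell\mathsf{A}_\ell$ with $\mathsf{A}_\ell=\int \mathrm{live}_\ell(t)\,dt$ the number of live bits at level $\ell$ integrated over time, plus $\sum_\ell c_\ell\mathsf{F}_\ell$ with $\mathsf{F}_\ell$ the number of bits crossing boundary $\ell$; these costs are dissipated in disjoint physical events. Values. A value is an annotation of the execution: a labeling of physical bits by pairs (value, bit position) over time, and of firings as copies or route firings. The creation $t^v_0$ of $v$ is the first instant a bit of $v$ is at a working level; the annotation may relabel resident bits to a new value, which is then created at that instant. The firing creating $v$ is exempt from (ii). "Resident" means held at level $0$. *)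

theory Defs
  imports "HOL-Analysis.Analysis"
begin

section \<open>Substrate, states and steps\<close>

text \<open>A cell is a pair (level, address).\<close>

type_synonym cell = "nat \<times> nat"

text \<open>Levels \<open>0, ..., env_level\<close>; the outermost one, \<open>env_level\<close>, is the environment, the levels below
  it are the working levels. \<open>fare l\<close> belongs to the boundary between levels \<open>l\<close> and \<open>l + 1\<close>.\<close>

record substrate =
  env_level :: nat
  capacity :: "nat \<Rightarrow> nat"
  hold_power :: "nat \<Rightarrow> real"
  fare :: "nat \<Rightarrow> real"
  word_size :: nat

definition wf_substrate :: "substrate \<Rightarrow> bool" where
  "wf_substrate sub \<longleftrightarrow>
     0 < env_level sub \<and>
     (\<forall>l. 0 \<le> hold_power sub l) \<and> hold_power sub (env_level sub) = 0 \<and>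
     (\<forall>l < env_level sub. 0 \<le> fare sub l)"

definition working :: "substrate \<Rightarrow> cell \<Rightarrow> bool" where
  "working sub c \<longleftrightarrow> fst c < env_level sub"

text \<open>\<open>contents s c = None\<close> means that the cell \<open>c\<close> is free.\<close>

record state =
  clock :: real
  contents :: "cell \<Rightarrow> bool option"

definition occupied :: "state \<Rightarrow> nat \<Rightarrow> nat set" where
  "occupied s l = {a. contents s (l, a) \<noteq> None}"

text \<open>The environment has no capacity bound; nothing exists beyond it.\<close>

definition wf_state :: "substrate \<Rightarrow> state \<Rightarrow> bool" where
  "wf_state sub s \<longleftrightarrow>
     (\<forall>l < env_level sub. finite (occupied s l) \<and> card (occupied s l) \<le> capacity sub l) \<and>
     (\<forall>l > env_level sub. occupied s l = {})"

text \<open>All stations reside at level 0: \<open>words\<close> are the start addresses of the level-0 words a firing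
  reads, and \<open>written\<close> maps the level-0 addresses it writes to the bits written there. \<open>freed\<close> may
  contain cells of any working level. \<open>dissipated\<close> is the energy of the operation itself.\<close>

datatype step =
    Hold (duration: real)
  | Move (source: cell) (target: cell)
  | Fire (words: "nat set") (written: "nat \<Rightarrow> bool option") (freed: "cell set") (dissipated: real)

fun step_rel :: "substrate \<Rightarrow> state \<Rightarrow> step \<Rightarrow> state \<Rightarrow> bool" where
  "step_rel sub s (Hold d) s' \<longleftrightarrow>
     0 < d \<and> clock s' = clock s + d \<and> contents s' = contents s"
| "step_rel sub s (Move x y) s' \<longleftrightarrow>
     (fst y = Suc (fst x) \<or> fst x = Suc (fst y)) \<and>
     contents s x \<noteq> None \<and> contents s y = None \<and>
     clock s' = clock s \<and> contents s' = (contents s)(y := contents s x)"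
| "step_rel sub s (Fire A W F e) s' \<longleftrightarrow>
     finite A \<and> card A \<le> 2 \<and>
     (\<forall>a\<in>A. \<forall>j < word_size sub. contents s (0, a + j) \<noteq> None) \<and>
     (\<forall>c\<in>F. working sub c \<and> contents s c \<noteq> None) \<and>
     0 \<le> e \<and>
     clock s' = clock s \<and>
     contents s' = (\<lambda>c. if fst c = 0 \<and> snd c \<in> dom W then W (snd c)
                        else if c \<in> F then None else contents s c)"

text \<open>Step \<open>n\<close> leads from state \<open>n\<close> to state \<open>n + 1\<close>.\<close>

record execution =
  states :: "state list"
  steps :: "step list"

definition wf_execution :: "substrate \<Rightarrow> execution \<Rightarrow> bool" where
  "wf_execution sub ex \<longleftrightarrow>
     length (states ex) = Suc (length (steps ex)) \<and>
     (\<forall>s \<in> set (states ex). wf_state sub s) \<and>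
     (\<forall>n < length (steps ex). step_rel sub (states ex ! n) (steps ex ! n) (states ex ! Suc n))"

definition time :: "execution \<Rightarrow> nat \<Rightarrow> real" where
  "time ex n = clock (states ex ! n)"

definition holds :: "execution \<Rightarrow> nat set" where
  "holds ex = {n. n < length (steps ex) \<and> is_Hold (steps ex ! n)}"

definition moves :: "execution \<Rightarrow> nat set" where
  "moves ex = {n. n < length (steps ex) \<and> is_Move (steps ex ! n)}"

definition firings :: "execution \<Rightarrow> nat set" where
  "firings ex = {n. n < length (steps ex) \<and> is_Fire (steps ex ! n)}"

definition read_cells :: "substrate \<Rightarrow> execution \<Rightarrow> nat \<Rightarrow> cell set" where
  "read_cells sub ex n = {(0, a + j) | a j. a \<in> words (steps ex ! n) \<and> j < word_size sub}"

definition written_cells :: "execution \<Rightarrow> nat \<Rightarrow> cell set" where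
  "written_cells ex n = {(0, a) | a. a \<in> dom (written (steps ex ! n))}"

section \<open>Energy\<close>

text \<open>The state in force at time \<open>t\<close>: the last state reached no later than \<open>t\<close>. At the finitely many
  instants shared by several states the choice is immaterial for the integral.\<close>

definition state_at :: "execution \<Rightarrow> real \<Rightarrow> state" where
  "state_at ex t = states ex ! Max {n. n < length (states ex) \<and> time ex n \<le> t}"

definition live_bits :: "execution \<Rightarrow> nat \<Rightarrow> real \<Rightarrow> nat" where
  "live_bits ex l t = card (occupied (state_at ex t) l)"

definition live_time :: "execution \<Rightarrow> nat \<Rightarrow> real" where
  "live_time ex l =
     integral {time ex 0 .. time ex (length (steps ex))} (\<lambda>t. real (live_bits ex l t))"

definition boundary :: "execution \<Rightarrow> nat \<Rightarrow> nat" where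
  "boundary ex n = min (fst (source (steps ex ! n))) (fst (target (steps ex ! n)))"

definition crossings :: "execution \<Rightarrow> nat \<Rightarrow> nat" where
  "crossings ex l = card {n \<in> moves ex. boundary ex n = l}"

definition op_energy :: "execution \<Rightarrow> nat \<Rightarrow> real" where
  "op_energy ex n = dissipated (steps ex ! n)"

text \<open>The energy of an execution is any real number at least this one.\<close>

definition energy_floor :: "substrate \<Rightarrow> execution \<Rightarrow> real" where
  "energy_floor sub ex =
     (\<Sum>n\<in>firings ex. op_energy ex n)
     + (\<Sum>l<env_level sub. hold_power sub l * live_time ex l)
     + (\<Sum>l<env_level sub. fare sub l * real (crossings ex l))"

text \<open>The disjoint physical events in which these costs are dissipated: a firing, the residence of one
  bit in one working cell during one hold, and the crossing of a boundary by one bit.\<close>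

datatype event = Firing nat | Residence nat cell | Crossing nat

definition events :: "substrate \<Rightarrow> execution \<Rightarrow> event set" where
  "events sub ex =
     Firing ` firings ex
     \<union> {Residence n c | n c. n \<in> holds ex \<and> working sub c \<and> contents (states ex ! n) c \<noteq> None}
     \<union> Crossing ` moves ex"

fun event_energy :: "substrate \<Rightarrow> execution \<Rightarrow> event \<Rightarrow> real" where
  "event_energy sub ex (Firing n) = op_energy ex n"
| "event_energy sub ex (Residence n c) = hold_power sub (fst c) * duration (steps ex ! n)"
| "event_energy sub ex (Crossing n) = fare sub (boundary ex n)"

section \<open>Annotations by values\<close>

text \<open>\<open>label an n v c = Some b\<close>: in state \<open>n\<close> the physical bit in cell \<open>c\<close> is a copy of bit \<open>b\<close> of value
  \<open>v\<close>. Labels of different values are independent of each other here, so that disjointness of values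
  is a genuine condition (\<open>values_disjoint\<close> below). \<open>copies\<close> is the set of steps annotated as copy
  firings; \<open>routes\<close> are the recomputation routes, each given as the set of its steps.\<close>

record 'v annotation =
  vals :: "'v set"
  footprint :: "'v \<Rightarrow> nat"
  label :: "nat \<Rightarrow> 'v \<Rightarrow> cell \<Rightarrow> nat option"
  copies :: "nat set"
  routes :: "nat set set"

definition value_live :: "substrate \<Rightarrow> 'v annotation \<Rightarrow> nat \<Rightarrow> 'v \<Rightarrow> bool" where
  "value_live sub an n v \<longleftrightarrow> (\<exists>c. working sub c \<and> label an n v c \<noteq> None)"

definition created_at :: "substrate \<Rightarrow> 'v annotation \<Rightarrow> 'v \<Rightarrow> nat \<Rightarrow> bool" where
  "created_at sub an v n \<longleftrightarrow> value_live sub an n v \<and> (\<forall>m<n. \<not> value_live sub an m v)"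

definition writes_of :: "execution \<Rightarrow> 'v annotation \<Rightarrow> nat \<Rightarrow> 'v \<Rightarrow> cell set" where
  "writes_of ex an n v = {c \<in> written_cells ex n. label an (Suc n) v c \<noteq> None}"

definition copies_value ::
  "substrate \<Rightarrow> execution \<Rightarrow> 'v annotation \<Rightarrow> nat \<Rightarrow> 'v \<Rightarrow> bool" where
  "copies_value sub ex an n v \<longleftrightarrow>
     writes_of ex an n v \<noteq> {} \<and>
     (\<forall>c \<in> writes_of ex an n v. \<exists>c' \<in> read_cells sub ex n. label an n v c' = label an (Suc n) v c)"

text \<open>How a cell may come to carry the label \<open>(v, b)\<close> in state \<open>n + 1\<close>: the bit in it is written by a
  firing, or arrives by a move of a bit labelled \<open>(v, b)\<close>, or was there already with that label, or is
  a resident bit relabelled to a value created in that very state. Labels may be dropped freely.\<close>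

definition label_origin ::
  "substrate \<Rightarrow> execution \<Rightarrow> 'v annotation \<Rightarrow> nat \<Rightarrow> 'v \<Rightarrow> cell \<Rightarrow> nat \<Rightarrow> bool" where
  "label_origin sub ex an n v c b \<longleftrightarrow>
     (n \<in> firings ex \<and> c \<in> written_cells ex n) \<or>
     (n \<in> moves ex \<and> c = target (steps ex ! n) \<and> label an n v (source (steps ex ! n)) = Some b) \<or>
     label an n v c = Some b \<or>
     (fst c = 0 \<and> created_at sub an v (Suc n))"

definition wf_annotation :: "substrate \<Rightarrow> execution \<Rightarrow> 'v annotation \<Rightarrow> bool" where
  "wf_annotation sub ex an \<longleftrightarrow>
     finite (vals an) \<and> (\<forall>v \<in> vals an. 0 < footprint an v) \<and>
     (\<forall>n \<le> length (steps ex). \<forall>v c b. label an n v c = Some b \<longrightarrow>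
        v \<in> vals an \<and> b < footprint an v \<and> contents (states ex ! n) c \<noteq> None) \<and>
     (\<forall>n < length (steps ex). \<forall>v c b. label an (Suc n) v c = Some b \<longrightarrow>
        label_origin sub ex an n v c b) \<and>
     copies an \<subseteq> firings ex \<and>
     (\<forall>n \<in> copies an. \<exists>v \<in> vals an. copies_value sub ex an n v)"

definition values_disjoint :: "substrate \<Rightarrow> execution \<Rightarrow> 'v annotation \<Rightarrow> bool" where
  "values_disjoint sub ex an \<longleftrightarrow>
     (\<forall>n \<le> length (steps ex). \<forall>v \<in> vals an. \<forall>u \<in> vals an.
        v \<noteq> u \<and> value_live sub an n v \<and> value_live sub an n u \<longrightarrow>
        dom (label an n v) \<inter> dom (label an n u) = {})"

definition route_of ::
  "substrate \<Rightarrow> execution \<Rightarrow> 'v annotation \<Rightarrow> real \<Rightarrow> nat set \<Rightarrow> 'v \<Rightarrow> bool" where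
  "route_of sub ex an \<gamma> R v \<longleftrightarrow>
     writes_of ex an (Max R) v \<noteq> {} \<and>
     (\<forall>n \<in> R. \<forall>u. writes_of ex an n u \<noteq> {} \<longrightarrow> u = v \<and> n = Max R) \<and>
     (\<forall>n \<in> R. \<forall>c \<in> read_cells sub ex n. label an n v c = None) \<and>
     \<gamma> * real (card (writes_of ex an (Max R) v)) \<le> (\<Sum>n\<in>R. op_energy ex n)"

definition route_firing ::
  "substrate \<Rightarrow> execution \<Rightarrow> 'v annotation \<Rightarrow> real \<Rightarrow> nat \<Rightarrow> 'v \<Rightarrow> bool" where
  "route_firing sub ex an \<gamma> n v \<longleftrightarrow> (\<exists>R \<in> routes an. n \<in> R \<and> route_of sub ex an \<gamma> R v)"

text \<open>The firing that creates \<open>v\<close> is exempt. A non-copy firing that writes no value bits,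
  or only creates values, need not belong to a route.\<close>

definition recomputation_discipline ::
  "substrate \<Rightarrow> execution \<Rightarrow> 'v annotation \<Rightarrow> real \<Rightarrow> bool" where
  "recomputation_discipline sub ex an \<gamma> \<longleftrightarrow>
     partition_on (\<Union>(routes an)) (routes an) \<and>
     \<Union>(routes an) \<subseteq> firings ex - copies an \<and>
     (\<forall>R \<in> routes an. \<exists>v \<in> vals an. route_of sub ex an \<gamma> R v) \<and>
     (\<forall>v \<in> vals an. \<forall>n \<in> firings ex.
        writes_of ex an n v \<noteq> {} \<and> \<not> created_at sub an v (Suc n) \<longrightarrow>
        (\<forall>u. u \<noteq> v \<longrightarrow> writes_of ex an n u = {}) \<and>
        (n \<in> copies an \<and> copies_value sub ex an n v \<or> route_firing sub ex an \<gamma> n v))"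

section \<open>Uses and charges\<close>

text \<open>An operation reads \<open>v\<close> if it reads every bit of \<open>v\<close>.\<close>

definition uses :: "substrate \<Rightarrow> execution \<Rightarrow> 'v annotation \<Rightarrow> 'v \<Rightarrow> nat set" where
  "uses sub ex an v =
     {n \<in> firings ex - copies an.
        \<forall>b < footprint an v. \<exists>c \<in> read_cells sub ex n. label an n v c = Some b}"

definition num_uses :: "substrate \<Rightarrow> execution \<Rightarrow> 'v annotation \<Rightarrow> 'v \<Rightarrow> nat" where
  "num_uses sub ex an v = card (uses sub ex an v)"

text \<open>\<open>mark v 0\<close> is the index of the state in which \<open>v\<close> is created, \<open>mark v i\<close> for \<open>1 \<le> i \<le> num_uses v\<close>
  that of the state in which the \<open>i\<close>-th use of \<open>v\<close> fires.\<close>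

fun mark :: "substrate \<Rightarrow> execution \<Rightarrow> 'v annotation \<Rightarrow> 'v \<Rightarrow> nat \<Rightarrow> nat" where
  "mark sub ex an v 0 = (LEAST n. value_live sub an n v)"
| "mark sub ex an v (Suc i) = sorted_list_of_set (uses sub ex an v) ! i"

definition gap :: "substrate \<Rightarrow> execution \<Rightarrow> 'v annotation \<Rightarrow> 'v \<Rightarrow> nat \<Rightarrow> real" where
  "gap sub ex an v i = time ex (mark sub ex an v i) - time ex (mark sub ex an v (i - 1))"

text \<open>Several states may share one instant, since moves and firings take no time, so \<open>every instant\<close> is
  rendered as every state from the creation (or the previous use) up to the use. A hold does not
  change the contents, so this includes all instants in between.\<close>

definition covered ::
  "substrate \<Rightarrow> execution \<Rightarrow> 'v annotation \<Rightarrow> 'v \<Rightarrow> nat \<Rightarrow> nat \<Rightarrow> bool" where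
  "covered sub ex an v i b \<longleftrightarrow>
     (\<forall>m \<in> {mark sub ex an v (i - 1) .. mark sub ex an v i}. \<exists>a. label an m v (0, a) = Some b)"

definition charge ::
  "substrate \<Rightarrow> execution \<Rightarrow> 'v annotation \<Rightarrow> real \<Rightarrow> 'v \<Rightarrow> nat \<Rightarrow> nat \<Rightarrow> real" where
  "charge sub ex an \<gamma> v i b =
     (if covered sub ex an v i b
      then min (hold_power sub 0 * gap sub ex an v i) (min (fare sub 0) \<gamma>)
      else min (fare sub 0) \<gamma>)"

definition independent_readers ::
  "substrate \<Rightarrow> execution \<Rightarrow> 'v annotation \<Rightarrow> real \<Rightarrow> nat set" where
  "independent_readers sub ex an \<gamma> =
     {n. \<exists>v \<in> vals an. n \<in> uses sub ex an v \<and> \<not> (\<exists>u. u \<noteq> v \<and> route_firing sub ex an \<gamma> n u)}"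

text \<open>A ledger gives every charge a share of the energy of the physical events; the shares of one event
  never exceed its energy, so charges are paid out of pairwise disjoint portions of energy.\<close>

definition pays_charges ::
  "substrate \<Rightarrow> execution \<Rightarrow> 'v annotation \<Rightarrow> real \<Rightarrow> ('v \<Rightarrow> nat \<Rightarrow> nat \<Rightarrow> event \<Rightarrow> real) \<Rightarrow> bool" where
  "pays_charges sub ex an \<gamma> share \<longleftrightarrow>
     (\<forall>v i b e. 0 \<le> share v i b e) \<and>
     (\<forall>e \<in> events sub ex.
        (\<Sum>v\<in>vals an. \<Sum>i=1..num_uses sub ex an v. \<Sum>b<footprint an v. share v i b e)
          \<le> event_energy sub ex e) \<and>
     (\<forall>v \<in> vals an. \<forall>i \<in> {1..num_uses sub ex an v}. \<forall>b < footprint an v.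
        charge sub ex an \<gamma> v i b \<le> (\<Sum>e\<in>events sub ex. share v i b e))"

end

theory Submission
  imports Defs
begin

text \<open>Between two consecutive uses, a covered bit always occupies some level-0 cell, so the residence of
  its copies there costs \<open>p\<^sub>0\<close> times the gap. A bit that is not covered reappears at level 0 before
  the use, either by crossing boundary 0 or by the last firing of a route. Each such event pays for
  only one triple \<open>(v, i, b)\<close>, and each route for at most as many as it writes bits: a physical bit
  carries one label, and the intervals between consecutive marks of a value are disjoint. Firings
  outside routes, among them the independent readers, pay nothing.\<close>

locale annotated_execution =
  fixes sub :: substrate and ex :: execution and an :: "'v annotation" and \<gamma> :: real
  assumes wf_sub: "wf_substrate sub"
    and wf_ex: "wf_execution sub ex"
    and wf_an: "wf_annotation sub ex an"
    and disj: "values_disjoint sub ex an"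
    and discipline: "recomputation_discipline sub ex an \<gamma>"
begin

section \<open>Steps and the clock\<close>

abbreviation N where "N \<equiv> length (steps ex)"

lemma length_states: "length (states ex) = Suc N"
  using wf_ex by (simp add: wf_execution_def)

lemma env_level_pos: "0 < env_level sub"
  and hold_power_nonneg: "0 \<le> hold_power sub l"
  and fare_nonneg: "l < env_level sub \<Longrightarrow> 0 \<le> fare sub l"
  using wf_sub by (auto simp: wf_substrate_def)

lemma state_wf: "n \<le> N \<Longrightarrow> wf_state sub (states ex ! n)"
  using wf_ex length_states by (auto simp: wf_execution_def)

lemma step_ok: "n < N \<Longrightarrow> step_rel sub (states ex ! n) (steps ex ! n) (states ex ! Suc n)"
  using wf_ex by (auto simp: wf_execution_def)

lemma finite_steps [simp]: "finite (holds ex)" "finite (moves ex)" "finite (firings ex)"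
  by (auto simp: holds_def moves_def firings_def)

lemma op_energy_nonneg: "n \<in> firings ex \<Longrightarrow> 0 \<le> op_energy ex n"
  using step_ok[of n] by (cases "steps ex ! n") (auto simp: firings_def op_energy_def)

lemma duration_pos: "n \<in> holds ex \<Longrightarrow> 0 < duration (steps ex ! n)"
  using step_ok[of n] by (cases "steps ex ! n") (auto simp: holds_def)

lemma time_Suc:
  "n < N \<Longrightarrow> time ex (Suc n) - time ex n = (if n \<in> holds ex then duration (steps ex ! n) else 0)"
  using step_ok[of n] by (cases "steps ex ! n") (auto simp: holds_def time_def)

text \<open>The difference telescopes, and only holds advance the clock. The range is half-open
  because step \<open>k\<close> ends in state \<open>Suc k\<close>.\<close>

lemma time_diff:
  assumes "m \<le> n" "n \<le> N"
  shows "time ex n - time ex m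
    = (\<Sum>k\<in>{m..<n}. if k \<in> holds ex then duration (steps ex ! k) else 0)"
proof -
  have "time ex n - time ex m = (\<Sum>k\<in>{m..<n}. time ex (Suc k) - time ex k)"
    using assms sum_Suc_diff'[of m n "time ex"] by simp
  also have "\<dots> = (\<Sum>k\<in>{m..<n}. if k \<in> holds ex then duration (steps ex ! k) else 0)"
    using assms by (intro sum.cong) (auto simp: time_Suc)
  finally show ?thesis .
qed

lemma time_mono: "m \<le> n \<Longrightarrow> n \<le> N \<Longrightarrow> time ex m \<le> time ex n"
  using time_diff[of m n] sum_nonneg[of "{m..<n}" "\<lambda>k. if k \<in> holds ex then duration (steps ex ! k) else 0"]
    duration_pos by (fastforce intro: less_imp_le)

section \<open>Live time as a finite sum over holds\<close>

lemma state_at_eq: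
  assumes "n < N" "time ex n \<le> t" "t < time ex (Suc n)"
  shows "state_at ex t = states ex ! n"
proof -
  have "Max {k. k < length (states ex) \<and> time ex k \<le> t} = n"
  proof (rule Max_eqI)
    fix k assume "k \<in> {k. k < length (states ex) \<and> time ex k \<le> t}"
    then show "k \<le> n"
      \<comment> \<open>Every state after \<open>n\<close> is reached no earlier than
        \<open>time ex (Suc n)\<close>, hence after \<open>t\<close>.\<close>
      using time_mono[of "Suc n" k] assms length_states by (fastforce simp: not_le)
  qed (use assms length_states in auto)
  then show ?thesis by (simp add: state_at_def)
qed

text \<open>The integrand is a step function in time; the induction appends the interval of one step
  after another, those of moves and firings being single points.\<close>

lemma live_bits_has_integral:
  assumes "n \<le> N"
  shows "((\<lambda>t. real (live_bits ex l t)) has_integral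
    (\<Sum>k<n. (time ex (Suc k) - time ex k) * real (card (occupied (states ex ! k) l))))
    {time ex 0 .. time ex n}"
  using assms
proof (induction n)
  case 0
  then show ?case using has_integral_null_real[of "time ex 0" "time ex 0"] by simp
next
  case (Suc n)
  let ?c = "real (card (occupied (states ex ! n) l))"
  have "((\<lambda>t. real (live_bits ex l t)) has_integral (time ex (Suc n) - time ex n) * ?c)
      {time ex n .. time ex (Suc n)}"
  \<comment> \<open>At the right endpoint \<open>state_at\<close> already gives a later state, so
    this one point is discarded. If step \<open>n\<close> takes no time, it is the whole
    interval.\<close>
  proof (rule has_integral_spike_finite[where S = "{time ex (Suc n)}"])
    show "((\<lambda>t. ?c) has_integral (time ex (Suc n) - time ex n) * ?c) {time ex n .. time ex (Suc n)}"
      using has_integral_const_real[of ?c "time ex n" "time ex (Suc n)"]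
        time_mono[of n "Suc n"] Suc.prems by simp
  qed (use Suc.prems in \<open>auto simp: live_bits_def state_at_eq[of n] less_le\<close>)
  then show ?case
    using has_integral_combine[OF time_mono[of 0 n] time_mono[of n "Suc n"] Suc.IH] Suc.prems
    by simp
qed

lemma live_time_eq:
  "live_time ex l
    = (\<Sum>n\<in>holds ex. duration (steps ex ! n) * real (card (occupied (states ex ! n) l)))"
proof -
  have "live_time ex l
      = (\<Sum>k<N. (time ex (Suc k) - time ex k) * real (card (occupied (states ex ! k) l)))"
    unfolding live_time_def using live_bits_has_integral[of N l] by (simp add: integral_unique)
  also have "\<dots> = (\<Sum>k\<in>holds ex. duration (steps ex ! k) * real (card (occupied (states ex ! k) l)))"
    by (rule sum.mono_neutral_cong_right) (auto simp: holds_def time_Suc)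
  finally show ?thesis .
qed

section \<open>Physical events and the energy floor\<close>

lemma finite_occupied: "n \<le> N \<Longrightarrow> l < env_level sub \<Longrightarrow> finite (occupied (states ex ! n) l)"
  using state_wf by (auto simp: wf_state_def)

text \<open>The nested \<open>SIGMA\<close> lets finiteness be checked level by level and splits
  sums into sums over holds, levels and addresses.\<close>

definition residences :: "(nat \<times> nat \<times> nat) set" where
  "residences = (SIGMA n:holds ex. SIGMA l:{..<env_level sub}. occupied (states ex ! n) l)"

lemma finite_residences [simp]: "finite residences"
  unfolding residences_def
  by (intro finite_SigmaI finite_steps finite_lessThan finite_occupied) (auto simp: holds_def)

lemma events_eq:
  "events sub ex = Firing ` firings ex \<union> (\<lambda>(n, c). Residence n c) ` residences \<union> Crossing ` moves ex"
  unfolding events_def residences_def occupied_def working_def by (force simp: image_iff)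

lemma finite_events [simp]: "finite (events sub ex)"
  by (simp add: events_eq)

lemma contents_level:
  "n \<le> N \<Longrightarrow> contents (states ex ! n) c \<noteq> None \<Longrightarrow> fst c \<le> env_level sub"
  using state_wf[of n] unfolding wf_state_def occupied_def
  by (metis (mono_tags, lifting) empty_Collect_eq leI prod.collapse)

text \<open>The source is occupied before the move and the target after it, so neither lies beyond
  the environment. Their levels are adjacent, so the lower one is a working level, and its fare is
  nonnegative.\<close>

lemma boundary_less: "n \<in> moves ex \<Longrightarrow> boundary ex n < env_level sub"
proof -
  assume n: "n \<in> moves ex"
  then obtain x y where xy: "steps ex ! n = Move x y" and "n < N"
    by (cases "steps ex ! n") (auto simp: moves_def)
  have r: "step_rel sub (states ex ! n) (Move x y) (states ex ! Suc n)"
    using step_ok \<open>n < N\<close> xy by metis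
  have "fst x \<le> env_level sub" "fst y \<le> env_level sub"
    using contents_level[of n x] contents_level[of "Suc n" y] \<open>n < N\<close> r by auto
  then show ?thesis using r by (auto simp: boundary_def xy)
qed

lemma event_energy_nonneg: "e \<in> events sub ex \<Longrightarrow> 0 \<le> event_energy sub ex e"
  using op_energy_nonneg hold_power_nonneg duration_pos fare_nonneg boundary_less
  by (auto simp: events_eq residences_def less_imp_le)

text \<open>Each summand of \<open>energy_floor\<close> collects one kind of event: residences are
  grouped by level, which yields the live times, and crossings by boundary.\<close>

lemma sum_event_energy: "(\<Sum>e\<in>events sub ex. event_energy sub ex e) = energy_floor sub ex"
proof -
  let ?f = "event_energy sub ex"
  have "(\<Sum>e\<in>(\<lambda>(n, c). Residence n c) ` residences. ?f e)
      = (\<Sum>(n, l, a)\<in>residences. hold_power sub l * duration (steps ex ! n))"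
    by (subst sum.reindex) (auto simp: inj_on_def intro!: sum.cong)
  also have "\<dots> = (\<Sum>n\<in>holds ex. \<Sum>l<env_level sub. \<Sum>a\<in>occupied (states ex ! n) l.
      hold_power sub l * duration (steps ex ! n))"
    unfolding residences_def
    by (subst sum.Sigma[symmetric]; (intro sum.cong refl)?)
       (auto simp: holds_def finite_occupied sum.Sigma[symmetric] split: prod.splits)
  also have "\<dots> = (\<Sum>l<env_level sub. hold_power sub l * live_time ex l)"
    by (subst sum.swap) (simp add: live_time_eq sum_distrib_left mult_ac)
  finally have res: "(\<Sum>e\<in>(\<lambda>(n, c). Residence n c) ` residences. ?f e)
      = (\<Sum>l<env_level sub. hold_power sub l * live_time ex l)" .
  have "(\<Sum>l<env_level sub. fare sub l * real (crossings ex l))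
      = (\<Sum>l<env_level sub. \<Sum>n\<in>{n \<in> moves ex. boundary ex n = l}. fare sub (boundary ex n))"
    by (simp add: crossings_def mult.commute)
  also have "\<dots> = (\<Sum>n\<in>moves ex. fare sub (boundary ex n))"
    by (rule sum.group) (auto simp: boundary_less)
  finally have cross: "(\<Sum>e\<in>Crossing ` moves ex. ?f e)
      = (\<Sum>l<env_level sub. fare sub l * real (crossings ex l))"
    by (subst sum.reindex) (auto simp: inj_on_def)
  have fire: "(\<Sum>e\<in>Firing ` firings ex. ?f e) = (\<Sum>n\<in>firings ex. op_energy ex n)"
    by (subst sum.reindex) (auto simp: inj_on_def)
  show ?thesis
    unfolding events_eq energy_floor_def res[symmetric] cross[symmetric] fire[symmetric]
    by (subst sum.union_disjoint; auto)+
qed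

section \<open>Labels of physical bits\<close>

lemma labelD:
  assumes "n \<le> N" "label an n v c = Some b"
  shows "v \<in> vals an" "b < footprint an v" "contents (states ex ! n) c \<noteq> None"
  using wf_an assms unfolding wf_annotation_def by blast+

lemma label_originD:
  "n < N \<Longrightarrow> label an (Suc n) v c = Some b \<Longrightarrow> label_origin sub ex an n v c b"
  using wf_an unfolding wf_annotation_def by blast

lemma finite_vals [simp]: "finite (vals an)"
  and footprint_pos: "v \<in> vals an \<Longrightarrow> 0 < footprint an v"
  using wf_an by (auto simp: wf_annotation_def)

text \<open>Level 0 is a working level, so a label there makes its value live, which is what
  \<open>values_disjoint\<close> requires of both values.\<close>

lemma label_unique:
  assumes "n \<le> N" "label an n v c = Some b" "label an n u c = Some b'" "fst c = 0"
  shows "u = v \<and> b' = b"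
proof -
  have "u = v"
  proof (rule ccontr)
    assume "u \<noteq> v"
    moreover have "value_live sub an n v" "value_live sub an n u"
      using assms env_level_pos unfolding value_live_def working_def by (metis option.distinct(1))+
    moreover have "v \<in> vals an" "u \<in> vals an"
      using labelD assms by blast+
    ultimately have "dom (label an n v) \<inter> dom (label an n u) = {}"
      using disj assms(1) unfolding values_disjoint_def by metis
    then show False using assms by blast
  qed
  then show ?thesis using assms by simp
qed

section \<open>Uses, marks and the intervals between them\<close>

abbreviation mk where "mk \<equiv> mark sub ex an"
abbreviation uses_of where "uses_of \<equiv> uses sub ex an"
abbreviation num where "num \<equiv> num_uses sub ex an"

lemma uses_firings: "uses_of v \<subseteq> firings ex"
  by (auto simp: uses_def)

lemma finite_uses [simp]: "finite (uses_of v)"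
  using uses_firings finite_subset finite_steps(3) by blast

lemma mark_in_uses:
  assumes "i \<in> {1..num v}"
  shows "mk v i \<in> uses_of v"
proof -
  obtain j where "i = Suc j" using assms by (cases i) auto
  then have "mk v i \<in> set (sorted_list_of_set (uses_of v))"
    using assms by (auto simp: num_uses_def simp del: set_sorted_list_of_set intro!: nth_mem)
  then show ?thesis by simp
qed

lemma use_label:
  assumes "n \<in> uses_of v" "b < footprint an v"
  obtains a where "(0, a) \<in> read_cells sub ex n" "label an n v (0, a) = Some b"
proof -
  obtain c where c: "c \<in> read_cells sub ex n" "label an n v c = Some b"
    using assms by (auto simp: uses_def)
  then have "c = (0, snd c)" by (auto simp: read_cells_def)
  then show thesis using that c by metis
qed

lemma mark_less_length: "i \<in> {1..num v} \<Longrightarrow> mk v i < N"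
  using subsetD[OF uses_firings mark_in_uses] by (simp add: firings_def)

text \<open>The footprint is positive, so a use reads at least bit 0, and it reads it at level
  0.\<close>

lemma use_live:
  assumes "v \<in> vals an" "n \<in> uses_of v"
  shows "value_live sub an n v"
proof -
  obtain a where "label an n v (0, a) = Some 0"
    using use_label[OF assms(2) footprint_pos[OF assms(1)]] by blast
  then show ?thesis
    unfolding value_live_def working_def using env_level_pos by (intro exI[of _ "(0, a)"]) simp
qed

text \<open>The uses are listed in increasing order, and the value is live at its first use, so its
  creation comes no later.\<close>

lemma mark_mono:
  assumes "v \<in> vals an" "i \<le> j" "j \<le> num v"
  shows "mk v i \<le> mk v j"
  using assms(2,3)
proof (induction j rule: dec_induct)
  case (step j)
  have "mk v j \<le> mk v (Suc j)"
  proof (cases j)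
    case 0
    have "value_live sub an (mk v (Suc j)) v"
      using step.prems by (intro use_live assms mark_in_uses) auto
    then show ?thesis unfolding 0 mark.simps(1) by (rule Least_le)
  next
    case (Suc k)
    then show ?thesis
      using step.prems by (auto simp: num_uses_def intro!: sorted_nth_mono)
  qed
  then show ?case using step by simp
qed simp

lemma live_mark_0:
  assumes "v \<in> vals an" "1 \<le> num v"
  shows "value_live sub an (mk v 0) v"
proof -
  have "value_live sub an (mk v 1) v"
    using assms by (intro use_live mark_in_uses) auto
  then show ?thesis unfolding mark.simps(1) by (rule LeastI)
qed

text \<open>Step \<open>n\<close> takes place in the \<open>i\<close>-th interval. The interval is
  half-open: the effect of its last step is visible in the state where the use fires, and the slots
  of one value do not overlap.\<close>

definition slot :: "'v \<Rightarrow> nat \<Rightarrow> nat \<Rightarrow> bool" where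
  "slot v i n \<longleftrightarrow> v \<in> vals an \<and> i \<in> {1..num v} \<and> mk v (i - 1) \<le> n \<and> n < mk v i"

lemma slot_unique: "slot v i n \<Longrightarrow> slot v j n \<Longrightarrow> i = j"
proof (induction i j rule: linorder_wlog)
  case (le i j)
  show ?case
  proof (rule ccontr)
    assume "i \<noteq> j"
    then have "mk v i \<le> mk v (j - 1)"
      using le by (intro mark_mono) (auto simp: slot_def)
    then show False using le by (auto simp: slot_def)
  qed
qed metis

text \<open>Inside a slot the value has been live since mark 0. This rules out both privileges of
  creation: relabelling of resident bits, and the exemption from the recomputation
  discipline.\<close>

lemma not_created_in_slot:
  assumes "slot v i n"
  shows "\<not> created_at sub an v (Suc n)"
proof -
  have "value_live sub an (mk v 0) v"
    using assms by (intro live_mark_0) (auto simp: slot_def)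
  moreover have "mk v 0 \<le> mk v (i - 1)"
    using assms by (intro mark_mono) (auto simp: slot_def)
  then have "mk v 0 < Suc n" using assms by (auto simp: slot_def simp del: mark.simps)
  ultimately show ?thesis unfolding created_at_def by blast
qed

section \<open>Routes and the restoration of uncovered bits\<close>

lemma written_finite: "n < N \<Longrightarrow> finite (writes_of ex an n v)"
proof -
  assume n: "n < N"
  \<comment> \<open>Labelled cells are occupied after the firing, and level 0 holds finitely many
    bits; so \<open>card\<close> of this set is a genuine count.\<close>
  have "writes_of ex an n v \<subseteq> Pair 0 ` occupied (states ex ! Suc n) 0"
    using labelD(3)[of "Suc n" v] n
    by (fastforce simp: writes_of_def written_cells_def occupied_def)
  then show ?thesis
    using finite_occupied[of "Suc n" 0] n env_level_pos by (auto intro: finite_subset)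
qed

lemma routes_disjoint: "R \<in> routes an \<Longrightarrow> R' \<in> routes an \<Longrightarrow> k \<in> R \<Longrightarrow> k \<in> R' \<Longrightarrow> R = R'"
  using discipline by (auto simp: recomputation_discipline_def partition_on_def disjoint_def)

lemma route_firings: "R \<in> routes an \<Longrightarrow> R \<subseteq> firings ex"
  using discipline by (auto simp: recomputation_discipline_def)

lemma route_finite: "R \<in> routes an \<Longrightarrow> finite R"
  using route_firings finite_subset finite_steps(3) by blast

lemma route_Max: "R \<in> routes an \<Longrightarrow> Max R \<in> R"
  using discipline
  by (intro Max_in route_finite) (auto simp: recomputation_discipline_def partition_on_def)

lemma route_exists: "R \<in> routes an \<Longrightarrow> \<exists>v\<in>vals an. route_of sub ex an \<gamma> R v"
  using discipline by (auto simp: recomputation_discipline_def)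

text \<open>An uncovered bit is absent from level 0 at some instant before the use, hence reappears there
  later; a copy firing cannot bring it back, since it would read it at level 0.\<close>

lemma uncovered_restored:
  assumes v: "v \<in> vals an" and i: "i \<in> {1..num v}" and b: "b < footprint an v"
    and uncov: "\<not> covered sub ex an v i b"
  obtains n where "n \<in> moves ex" "slot v i n" "boundary ex n = 0" "fst (target (steps ex ! n)) = 0"
      "label an (Suc n) v (target (steps ex ! n)) = Some b"
  | R c where "R \<in> routes an" "slot v i (Max R)" "c \<in> writes_of ex an (Max R) v"
      "label an (Suc (Max R)) v c = Some b"
proof -
  let ?P = "\<lambda>m. \<exists>a. label an m v (0, a) = Some b"
  obtain m where m: "mk v (i - 1) \<le> m" "m \<le> mk v i" "\<not> ?P m"
    using uncov by (auto simp: covered_def)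
  have use: "?P (mk v i)"
    using use_label[OF mark_in_uses[OF i] b] by blast
  \<comment> \<open>The bit is absent in state \<open>m\<close> and present at the use, so some step
    in between turns absence into presence.\<close>
  have "\<exists>n. m \<le> n \<and> n < mk v i \<and> \<not> ?P n \<and> ?P (Suc n)"
  proof (rule ccontr)
    assume *: "\<not> ?thesis"
    have "\<not> ?P (mk v i)"
      using m(2) by (induction rule: dec_induct) (use * m(3) in auto)
    then show False using use by simp
  qed
  then obtain n a where n: "m \<le> n" "n < mk v i" "\<not> ?P n"
    and a: "label an (Suc n) v (0, a) = Some b" by blast
  have nN: "n < N" using n mark_less_length[OF i] by simp
  have slot: "slot v i n" using v i m n by (auto simp: slot_def)
  have "label_origin sub ex an n v (0, a) b"
    using label_originD nN a by blast
  \<comment> \<open>Of the four origins of a label, persistence is excluded by absence in state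
    \<open>n\<close>, and relabelling because the value is older than the slot.\<close>
  then consider "n \<in> firings ex" "(0, a) \<in> written_cells ex n"
    | "n \<in> moves ex" "(0, a) = target (steps ex ! n)"
      "label an n v (source (steps ex ! n)) = Some b"
    using not_created_in_slot[OF slot] n(3) by (auto simp: label_origin_def)
  then show thesis
  proof cases
    case 1
    then have w: "(0, a) \<in> writes_of ex an n v" using a by (simp add: writes_of_def)
    have "\<not> copies_value sub ex an n v"
    proof
      assume "copies_value sub ex an n v"
      then obtain c' where "c' \<in> read_cells sub ex n" "label an n v c' = Some b"
        using w a unfolding copies_value_def by metis
      then show False using n(3) by (auto simp: read_cells_def)
    qed
    then have "route_firing sub ex an \<gamma> n v"
      using discipline v 1 w not_created_in_slot[OF slot]
      unfolding recomputation_discipline_def by blast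
    then obtain R where R: "R \<in> routes an" "n \<in> R" "route_of sub ex an \<gamma> R v"
      by (auto simp: route_firing_def)
    \<comment> \<open>A route writes value bits only in its last firing.\<close>
    then have "n = Max R" using w unfolding route_of_def by blast
    then show thesis using that(2)[OF R(1)] slot w a by blast
  next
    case 2
    then obtain x where x: "steps ex ! n = Move x (0, a)"
      by (cases "steps ex ! n") (auto simp: moves_def)
    have "step_rel sub (states ex ! n) (Move x (0, a)) (states ex ! Suc n)"
      using step_ok[OF nN] x by simp
    then have "boundary ex n = 0" by (auto simp: boundary_def x)
    then show thesis using 2 slot a x by (intro that(1)[of n]) simp_all
  qed
qed

section \<open>The ledger of shares\<close>

text \<open>Summed over the firings of a route, the shares of a restored bit give \<open>\<gamma>\<close>, since the total energy
  in the denominator is positive if \<open>\<gamma> > 0\<close>. The sets in \<open>routes an\<close> are disjoint, so the union below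
  is the unique route containing \<open>k\<close>, or empty.\<close>

fun share :: "'v \<Rightarrow> nat \<Rightarrow> nat \<Rightarrow> event \<Rightarrow> real" where
  "share v i b (Firing k) =
     (let R = \<Union>{R \<in> routes an. k \<in> R} in
      if k \<in> R \<and> slot v i (Max R)
         \<and> (\<exists>c\<in>writes_of ex an (Max R) v. label an (Suc (Max R)) v c = Some b)
      then max 0 \<gamma> * (op_energy ex k / (\<Sum>j\<in>R. op_energy ex j)) else 0)"
| "share v i b (Residence n c) =
     (if n \<in> holds ex \<and> slot v i n \<and> c = (0, LEAST a. label an n v (0, a) = Some b)
         \<and> label an n v c = Some b
      then hold_power sub 0 * duration (steps ex ! n) else 0)"
| "share v i b (Crossing n) =
     (if n \<in> moves ex \<and> slot v i n \<and> boundary ex n = 0 \<and> fst (target (steps ex ! n)) = 0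
         \<and> label an (Suc n) v (target (steps ex ! n)) = Some b
      then fare sub 0 else 0)"

declare share.simps [simp del]

lemma the_route: "R \<in> routes an \<Longrightarrow> k \<in> R \<Longrightarrow> \<Union>{R \<in> routes an. k \<in> R} = R"
  using routes_disjoint by blast

lemma share_Firing:
  assumes "R \<in> routes an" "k \<in> R"
  shows "share v i b (Firing k) =
    (if slot v i (Max R) \<and> (\<exists>c\<in>writes_of ex an (Max R) v. label an (Suc (Max R)) v c = Some b)
     then max 0 \<gamma> * (op_energy ex k / (\<Sum>j\<in>R. op_energy ex j)) else 0)"
  using assms by (simp add: the_route share.simps)

lemma share_Firing_outside: "k \<notin> \<Union>(routes an) \<Longrightarrow> share v i b (Firing k) = 0"
proof -
  assume "k \<notin> \<Union>(routes an)"
  then have "k \<notin> \<Union>{R \<in> routes an. k \<in> R}" by blast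
  then show ?thesis by (simp only: share.simps Let_def simp_thms if_False)
qed

lemma route_energy_nonneg: "R \<in> routes an \<Longrightarrow> 0 \<le> (\<Sum>j\<in>R. op_energy ex j)"
  by (intro sum_nonneg op_energy_nonneg) (rule subsetD[OF route_firings])

text \<open>The truncation \<open>max 0 \<gamma>\<close> handles a negative \<open>\<gamma>\<close>,
  and for a route of total energy 0 the quotient is 0.\<close>

lemma share_nonneg: "0 \<le> share v i b e"
proof (cases e)
  case (Firing k)
  show ?thesis
  proof (cases "k \<in> \<Union>(routes an)")
    case True
    then obtain R where R: "R \<in> routes an" "k \<in> R" by blast
    then show ?thesis
      unfolding Firing share_Firing[OF R]
      using route_energy_nonneg[OF R(1)] op_energy_nonneg[OF subsetD[OF route_firings[OF R(1)] R(2)]]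
      by (simp del: times_divide_eq_right)
  qed (simp add: Firing share_Firing_outside)
next
  case (Residence n c)
  then show ?thesis using hold_power_nonneg duration_pos by (auto simp: share.simps less_imp_le)
next
  case (Crossing n)
  then show ?thesis using fare_nonneg[OF env_level_pos] by (simp add: share.simps)
qed

section \<open>No event pays more than its energy\<close>

definition triples :: "('v \<times> nat \<times> nat) set" where
  "triples = (SIGMA v:vals an. {1..num v} \<times> {..<footprint an v})"

lemma finite_triples [simp]: "finite triples"
  by (auto simp: triples_def)

lemma sum_triples:
  "(\<Sum>v\<in>vals an. \<Sum>i=1..num v. \<Sum>b<footprint an v. f v i b) = (\<Sum>(v, i, b)\<in>triples. f v i b)"
  for f :: "'v \<Rightarrow> nat \<Rightarrow> nat \<Rightarrow> real"
  unfolding triples_def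
  by (subst sum.Sigma[symmetric]) (auto simp: sum.cartesian_product)

lemma sum_triples_if:
  "(\<Sum>(v, i, b)\<in>triples. if Q v i b then q else 0)
    = q * real (card {(v, i, b) \<in> triples. Q v i b})" for q :: real
proof -
  have "(\<Sum>(v, i, b)\<in>triples. if Q v i b then q else 0)
      = (\<Sum>x\<in>{(v, i, b) \<in> triples. Q v i b}. q)"
    by (rule sum.mono_neutral_cong_right) (auto split: if_split_asm)
  then show ?thesis by (simp add: mult.commute)
qed

text \<open>This is for residences and crossings, each of which serves at most one triple.\<close>

lemma sum_at_most_one:
  fixes q :: real
  assumes "0 \<le> q"
    and "\<And>v i b v' i' b'. Q v i b \<Longrightarrow> Q v' i' b' \<Longrightarrow> v = v' \<and> i = i' \<and> b = b'"
  shows "(\<Sum>(v, i, b)\<in>triples. if Q v i b then q else 0) \<le> q"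
proof -
  have "finite {(v, i, b) \<in> triples. Q v i b}"
    by (rule finite_subset[OF _ finite_triples]) auto
  then have "card {(v, i, b) \<in> triples. Q v i b} \<le> 1"
    unfolding One_nat_def by (subst card_le_Suc0_iff_eq) (auto dest: assms(2))
  then have "q * real (card {(v, i, b) \<in> triples. Q v i b}) \<le> q * 1"
    using assms(1) by (intro mult_left_mono) auto
  then show ?thesis unfolding sum_triples_if by simp
qed

text \<open>The state \<open>m\<close> and the step \<open>n\<close> are kept apart because a
  residence looks at the label in state \<open>n\<close>, a crossing at the label in state
  \<open>Suc n\<close>.\<close>

lemma slot_label_unique:
  assumes "m \<le> N" "fst c = 0" "slot v i n" "label an m v c = Some b"
    and "slot v' i' n" "label an m v' c = Some b'"
  shows "v = v' \<and> i = i' \<and> b = b'"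
  using label_unique[OF assms(1,4,6,2)] slot_unique assms(3,5) by blast

lemma residence_bound:
  assumes "n \<in> holds ex"
  shows "(\<Sum>(v, i, b)\<in>triples. share v i b (Residence n c))
    \<le> hold_power sub (fst c) * duration (steps ex ! n)"
proof (cases "fst c = 0")
  case True
  have "n \<le> N" using assms by (simp add: holds_def)
  moreover have "0 \<le> hold_power sub 0 * duration (steps ex ! n)"
    using hold_power_nonneg duration_pos[OF assms] by (simp add: less_imp_le)
  ultimately show ?thesis
    unfolding share.simps True
    by (intro sum_at_most_one) (metis slot_label_unique[OF _ True])+
next
  case False
  then have "(\<Sum>(v, i, b)\<in>triples. share v i b (Residence n c)) = 0"
    by (intro sum.neutral) (auto simp: share.simps)
  then show ?thesis using hold_power_nonneg duration_pos[OF assms] by (simp add: less_imp_le)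
qed

lemma crossing_bound:
  assumes "n \<in> moves ex"
  shows "(\<Sum>(v, i, b)\<in>triples. share v i b (Crossing n)) \<le> fare sub (boundary ex n)"
proof (cases "boundary ex n = 0")
  case True
  have "Suc n \<le> N" using assms by (simp add: moves_def)
  moreover have "0 \<le> fare sub 0" using fare_nonneg env_level_pos .
  ultimately show ?thesis
    unfolding share.simps True
    by (intro sum_at_most_one) (metis slot_label_unique)+
next
  case False
  then have "(\<Sum>(v, i, b)\<in>triples. share v i b (Crossing n)) = 0"
    by (intro sum.neutral) (auto simp: share.simps)
  then show ?thesis using fare_nonneg[OF boundary_less[OF assms]] by simp
qed

text \<open>A written cell determines the triple it restores: the value is that of the route, the
  slot index follows from the value and \<open>Max R\<close>, and the bit is the label. Several
  cells may carry the same bit, hence only an inequality.\<close>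

lemma route_restorations:
  assumes R: "R \<in> routes an" and v: "route_of sub ex an \<gamma> R v"
  shows "card {(u, i, b) \<in> triples. slot u i (Max R) \<and>
           (\<exists>c\<in>writes_of ex an (Max R) u. label an (Suc (Max R)) u c = Some b)}
         \<le> card (writes_of ex an (Max R) v)" (is "card ?T \<le> card ?W")
proof -
  have "Max R < N" using route_Max route_firings R by (fastforce simp: firings_def)
  then have fin: "finite ?W" by (rule written_finite)
  let ?g = "\<lambda>c. (v, THE i. slot v i (Max R), the (label an (Suc (Max R)) v c))"
  have "?T \<subseteq> ?g ` ?W"
  proof
    fix x assume "x \<in> ?T"
    then obtain u i b c where x: "x = (u, i, b)" and s: "slot u i (Max R)"
      and c: "c \<in> writes_of ex an (Max R) u" "label an (Suc (Max R)) u c = Some b" by auto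
    have u: "u = v" using v c(1) route_Max[OF R] unfolding route_of_def by blast
    have "(THE i. slot v i (Max R)) = i"
      using s slot_unique u by blast
    then show "x \<in> ?g ` ?W" using x c u by (auto intro!: rev_image_eqI)
  qed
  then show ?thesis using fin by (meson card_image_le card_mono finite_imageI order_trans)
qed

text \<open>The energy of the route covers \<open>\<gamma>\<close> for every labelled bit it writes,
  hence for every triple it restores. Each firing bears a part proportional to its own energy, so
  what the whole route can afford, each of its firings can afford.\<close>

lemma firing_bound:
  assumes "k \<in> firings ex"
  shows "(\<Sum>(v, i, b)\<in>triples. share v i b (Firing k)) \<le> op_energy ex k"
proof (cases "k \<in> \<Union>(routes an)")
  case True
  then obtain R where R: "R \<in> routes an" "k \<in> R" by blast
  obtain v where v: "route_of sub ex an \<gamma> R v" using route_exists R(1) by blast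
  let ?S = "\<Sum>j\<in>R. op_energy ex j"
  let ?c = "card (writes_of ex an (Max R) v)"
  have nn: "0 \<le> op_energy ex k / ?S"
    using op_energy_nonneg[OF assms] route_energy_nonneg[OF R(1)] by simp
  have S: "max 0 \<gamma> * real ?c \<le> ?S"
    using v route_energy_nonneg[OF R(1)] by (auto simp: route_of_def max_def)
  have "(\<Sum>(v, i, b)\<in>triples. share v i b (Firing k))
      \<le> max 0 \<gamma> * (op_energy ex k / ?S) * real ?c"
    unfolding share_Firing[OF R] sum_triples_if
    using route_restorations[OF R(1) v] nn by (intro mult_left_mono mult_nonneg_nonneg) auto
  also have "\<dots> = (op_energy ex k / ?S) * (max 0 \<gamma> * real ?c)" by simp
  also have "\<dots> \<le> (op_energy ex k / ?S) * ?S"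
    using S nn by (rule mult_left_mono)
  \<comment> \<open>Equality holds if \<open>?S\<close> is nonzero; otherwise the left side is
    0.\<close>
  also have "\<dots> \<le> op_energy ex k" using op_energy_nonneg[OF assms] by simp
  finally show ?thesis .
next
  case False
  then show ?thesis using op_energy_nonneg[OF assms] by (simp add: share_Firing_outside)
qed

lemma shares_le_energy:
  assumes "e \<in> events sub ex"
  shows "(\<Sum>(v, i, b)\<in>triples. share v i b e) \<le> event_energy sub ex e"
proof (cases e)
  case (Firing k)
  then show ?thesis using assms firing_bound[of k] by (auto simp: events_def)
next
  case (Residence n c)
  then show ?thesis using assms residence_bound[of n c] by (auto simp: events_def)
next
  case (Crossing n)
  then show ?thesis using assms crossing_bound[of n] by (auto simp: events_def)
qed

section \<open>Every charge is paid\<close>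

lemma charge_covered:
  assumes v: "v \<in> vals an" and i: "i \<in> {1..num v}" and cov: "covered sub ex an v i b"
  shows "hold_power sub 0 * gap sub ex an v i \<le> (\<Sum>e\<in>events sub ex. share v i b e)"
proof -
  let ?I = "{mk v (i - 1)..<mk v i} \<inter> holds ex"
  \<comment> \<open>The least address picks one resident copy per hold. The cell may change from
    hold to hold, since moves and firings in between can alter the copies.\<close>
  let ?a = "\<lambda>n. LEAST a. label an n v (0, a) = Some b"
  let ?r = "\<lambda>n. Residence n (0, ?a n)"
  have lab: "label an n v (0, ?a n) = Some b" if "n \<in> ?I" for n
    using cov that by (auto simp: covered_def intro: LeastI_ex)
  have "gap sub ex an v i = (\<Sum>n\<in>?I. duration (steps ex ! n))"
    unfolding gap_def using mark_mono[OF v, of "i - 1" i] mark_less_length[OF i] i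
    by (subst time_diff) (auto simp: sum.inter_restrict)
  then have "hold_power sub 0 * gap sub ex an v i
      = (\<Sum>n\<in>?I. hold_power sub 0 * duration (steps ex ! n))"
    by (simp add: sum_distrib_left)
  also have "\<dots> = (\<Sum>n\<in>?I. share v i b (?r n))"
  proof (rule sum.cong)
    fix n assume n: "n \<in> ?I"
    then have "slot v i n" using v i by (simp add: slot_def)
    then show "hold_power sub 0 * duration (steps ex ! n) = share v i b (?r n)"
      using lab[OF n] n by (simp add: share.simps)
  qed simp
  also have "\<dots> = (\<Sum>e\<in>?r ` ?I. share v i b e)"
    by (subst sum.reindex) (auto simp: inj_on_def)
  also have "\<dots> \<le> (\<Sum>e\<in>events sub ex. share v i b e)"
  proof (rule sum_mono2)
    show "?r ` ?I \<subseteq> events sub ex"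
    proof
      fix e assume "e \<in> ?r ` ?I"
      then obtain n where n: "n \<in> ?I" "e = ?r n" by blast
      have "n \<le> N" using n(1) by (simp add: holds_def)
      then have "contents (states ex ! n) (0, ?a n) \<noteq> None" using labelD(3) lab[OF n(1)] by blast
      then show "e \<in> events sub ex"
        using n env_level_pos by (simp add: events_def working_def)
    qed
  qed (auto simp: share_nonneg)
  finally show ?thesis .
qed

lemma charge_uncovered:
  assumes v: "v \<in> vals an" and i: "i \<in> {1..num v}" and b: "b < footprint an v"
    and uncov: "\<not> covered sub ex an v i b"
  shows "min (fare sub 0) \<gamma> \<le> (\<Sum>e\<in>events sub ex. share v i b e)"
proof (rule uncovered_restored[OF v i b uncov])
  fix n assume n: "n \<in> moves ex" "slot v i n" "boundary ex n = 0" "fst (target (steps ex ! n)) = 0"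
      "label an (Suc n) v (target (steps ex ! n)) = Some b"
  have "fare sub 0 = share v i b (Crossing n)" using n by (simp add: share.simps)
  also have "\<dots> \<le> (\<Sum>e\<in>events sub ex. share v i b e)"
    using n by (intro member_le_sum share_nonneg finite_events) (auto simp: events_def)
  finally show ?thesis by simp
next
  fix R c assume R: "R \<in> routes an" "slot v i (Max R)" and c: "c \<in> writes_of ex an (Max R) v"
      "label an (Suc (Max R)) v c = Some b"
  show ?thesis
  proof (cases "\<gamma> > 0")
    case True
    let ?S = "\<Sum>j\<in>R. op_energy ex j"
    obtain u where u: "route_of sub ex an \<gamma> R u" using route_exists R(1) by blast
    have "Max R < N" using route_Max route_firings R by (fastforce simp: firings_def)
    \<comment> \<open>A route writes at least one labelled bit, so it dissipates at least
      \<open>\<gamma>\<close>, and the denominator in the shares is positive.\<close>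
    then have "0 < card (writes_of ex an (Max R) u)"
      using u written_finite by (simp add: route_of_def card_gt_0_iff)
    then have "0 < ?S"
      using u True unfolding route_of_def
      by (smt (verit) mult_pos_pos of_nat_0_less_iff)
    then have "\<gamma> = \<gamma> * ((\<Sum>k\<in>R. op_energy ex k) / ?S)" by simp
    also have "\<dots> = (\<Sum>k\<in>R. max 0 \<gamma> * (op_energy ex k / ?S))"
      using True by (simp only: sum_divide_distrib sum_distrib_left max_absorb2[OF less_imp_le])
    also have "\<dots> = (\<Sum>k\<in>R. share v i b (Firing k))"
      using R c by (intro sum.cong refl) (auto simp: share_Firing)
    also have "\<dots> = (\<Sum>e\<in>Firing ` R. share v i b e)"
      by (subst sum.reindex) (auto simp: inj_on_def)
    also have "\<dots> \<le> (\<Sum>e\<in>events sub ex. share v i b e)"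
      using route_firings[OF R(1)]
      by (intro sum_mono2 share_nonneg finite_events) (auto simp: events_def)
    finally show ?thesis by simp
  next
    case False
    \<comment> \<open>Here the charge is at most \<open>\<gamma>\<close>, hence at most 0.\<close>
    then show ?thesis using share_nonneg by (meson linorder_not_less min.coboundedI2 order_trans sum_nonneg)
  qed
qed

lemma charge_paid:
  assumes "v \<in> vals an" "i \<in> {1..num v}" "b < footprint an v"
  shows "charge sub ex an \<gamma> v i b \<le> (\<Sum>e\<in>events sub ex. share v i b e)"
  using charge_covered[OF assms(1,2), of b] charge_uncovered[OF assms] by (auto simp: charge_def)

lemma pays: "pays_charges sub ex an \<gamma> share"
  unfolding pays_charges_def sum_triples using share_nonneg shares_le_energy charge_paid by blast

section \<open>Independent readers and the total bound\<close>

text \<open>A use of \<open>v\<close> reads bits of \<open>v\<close>, so it belongs to no route of \<open>v\<close>.\<close>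

lemma independent_reader_not_in_route:
  assumes "n \<in> independent_readers sub ex an \<gamma>"
  shows "n \<notin> \<Union>(routes an)"
proof
  assume "n \<in> \<Union>(routes an)"
  then obtain R u where R: "R \<in> routes an" "n \<in> R" "route_of sub ex an \<gamma> R u"
    using route_exists by blast
  obtain v where v: "v \<in> vals an" "n \<in> uses_of v" "\<And>u. u \<noteq> v \<Longrightarrow> \<not> route_firing sub ex an \<gamma> n u"
    using assms by (auto simp: independent_readers_def)
  have "u = v" using R v(3) by (auto simp: route_firing_def)
  moreover obtain a where "(0, a) \<in> read_cells sub ex n" "label an n v (0, a) = Some 0"
    using use_label[OF v(2) footprint_pos[OF v(1)]] by blast
  ultimately show False using R by (fastforce simp: route_of_def)
qed

lemma share_independent_reader:
  "n \<in> independent_readers sub ex an \<gamma> \<Longrightarrow> share v i b (Firing n) = 0"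
  using independent_reader_not_in_route share_Firing_outside by blast

lemma independent_readers_firings: "independent_readers sub ex an \<gamma> \<subseteq> firings ex"
  using uses_firings by (auto simp: independent_readers_def)

text \<open>Double counting: the charges are bounded by the shares, summed event by event. The
  firings of independent readers carry share 0, so they can be removed before shares are compared
  with energies, which leaves their whole energy over.\<close>

lemma charges_plus_readers:
  "(\<Sum>v\<in>vals an. \<Sum>i=1..num v. \<Sum>b<footprint an v. charge sub ex an \<gamma> v i b)
     + (\<Sum>n\<in>independent_readers sub ex an \<gamma>. op_energy ex n) \<le> energy_floor sub ex"
proof -
  let ?I = "Firing ` independent_readers sub ex an \<gamma>"
  have sub: "?I \<subseteq> events sub ex" using independent_readers_firings by (auto simp: events_def)
  have "(\<Sum>(v, i, b)\<in>triples. charge sub ex an \<gamma> v i b)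
      \<le> (\<Sum>(v, i, b)\<in>triples. \<Sum>e\<in>events sub ex. share v i b e)"
    using charge_paid by (intro sum_mono) (auto simp: triples_def)
  also have "\<dots> = (\<Sum>e\<in>events sub ex. \<Sum>(v, i, b)\<in>triples. share v i b e)"
    unfolding case_prod_beta by (rule sum.swap)
  also have "\<dots> = (\<Sum>e\<in>events sub ex - ?I. \<Sum>(v, i, b)\<in>triples. share v i b e)"
    using sub by (intro sum.mono_neutral_right) (auto simp: share_independent_reader intro!: sum.neutral)
  also have "\<dots> \<le> (\<Sum>e\<in>events sub ex - ?I. event_energy sub ex e)"
    using shares_le_energy by (intro sum_mono) blast
  also have "\<dots> = energy_floor sub ex - (\<Sum>e\<in>?I. event_energy sub ex e)"
    using sum_diff[OF finite_events sub, of "event_energy sub ex"] sum_event_energy by simp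
  also have "(\<Sum>e\<in>?I. event_energy sub ex e) = (\<Sum>n\<in>independent_readers sub ex an \<gamma>. op_energy ex n)"
    by (subst sum.reindex) (auto simp: inj_on_def)
  finally show ?thesis unfolding sum_triples by simp
qed

text \<open>The minimum of all three quantities lies below both cases of
  \<open>charge\<close>.\<close>

lemma uniform_charge_le:
  "(\<Sum>v\<in>vals an. \<Sum>i=1..num v. real (footprint an v) *
      min (hold_power sub 0 * gap sub ex an v i) (min (fare sub 0) \<gamma>))
   \<le> (\<Sum>v\<in>vals an. \<Sum>i=1..num v. \<Sum>b<footprint an v. charge sub ex an \<gamma> v i b)"
proof (intro sum_mono)
  fix v i
  have "(\<Sum>b<footprint an v. min (hold_power sub 0 * gap sub ex an v i) (min (fare sub 0) \<gamma>))
      \<le> (\<Sum>b<footprint an v. charge sub ex an \<gamma> v i b)"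
    by (intro sum_mono) (auto simp: charge_def simp del: min.bounded_iff)
  then show "real (footprint an v) * min (hold_power sub 0 * gap sub ex an v i) (min (fare sub 0) \<gamma>)
      \<le> (\<Sum>b<footprint an v. charge sub ex an \<gamma> v i b)" by simp
qed

end

theorem lemma1:
  fixes sub :: substrate and ex :: execution and an :: "'v annotation" and \<gamma> E :: real
  assumes "wf_substrate sub"
    and "wf_execution sub ex"
    and "energy_floor sub ex \<le> E"
    and "wf_annotation sub ex an"
    and "values_disjoint sub ex an"
    and "recomputation_discipline sub ex an \<gamma>"
  shows "(\<Sum>v\<in>vals an. \<Sum>i=1..num_uses sub ex an v. \<Sum>b<footprint an v.
             charge sub ex an \<gamma> v i b) \<le> E \<and>
         (\<Sum>v\<in>vals an. \<Sum>i=1..num_uses sub ex an v. real (footprint an v) *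
             min (hold_power sub 0 * gap sub ex an v i) (min (fare sub 0) \<gamma>)) \<le> E \<and>
         (\<exists>share. pays_charges sub ex an \<gamma> share \<and>
           (\<forall>n \<in> independent_readers sub ex an \<gamma>. \<forall>v i b. share v i b (Firing n) = 0)) \<and>
         (\<Sum>v\<in>vals an. \<Sum>i=1..num_uses sub ex an v. \<Sum>b<footprint an v.
             charge sub ex an \<gamma> v i b)
           + (\<Sum>n \<in> independent_readers sub ex an \<gamma>. op_energy ex n) \<le> E"
proof -
  interpret annotated_execution sub ex an \<gamma>
    using assms by unfold_locales
  \<comment> \<open>Thus the bounds without the readers follow from the one that includes
    them.\<close>
  have "0 \<le> (\<Sum>n\<in>independent_readers sub ex an \<gamma>. op_energy ex n)"
    using independent_readers_firings op_energy_nonneg by (blast intro: sum_nonneg)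
  note bounds = this charges_plus_readers uniform_charge_le assms(3)
  show ?thesis
  proof (intro conjI)
    show "\<exists>share. pays_charges sub ex an \<gamma> share \<and>
        (\<forall>n \<in> independent_readers sub ex an \<gamma>. \<forall>v i b. share v i b (Firing n) = 0)"
      using pays share_independent_reader by blast
  qed (use bounds in linarith)+
qed

end
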